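(* Let $K$ be an algebraically closed field, $S=K[y_0,\dots,y_n]$, $\mathfrak M=(y_0,\dots,y_n)$, and let $\mathfrak I\subset S$ be a homogeneous ideal with $\mathfrak I^{sat}\subsetneq\mathfrak M$. A standard basis $\mathcal B$ of $\mathfrak I$ is e-maximal (respectively e-minimal) if and only if all the elements of $\mathcal B$ that are inessential (respectively essential) with respect to $\mathcal B$ are strongly inessential (respectively strongly essential).
   Context: For a homogeneous ideal $\mathfrak I$, $\mathfrak I^{sat}=\{f\in S:\ f\,\mathfrak M^t\subseteq\mathfrak I\text{ for some }t\in\mathbb N\}$. A standard basis of $\mathfrak I$ is an ordered set of forms generating $\mathfrak I$ such that, for each $d$, its elements of degree $d$ define a $K$-basis of $\mathfrak I_d/(\mathfrak I_{d-1}S_1)$. An element $f$ of a standard basis $\mathcal B$ is inessential with respect to $\mathcal B$ if $f\in\mathfrak H^{sat}$, where $\mathfrak H$ is the ideal generated by $\mathcal B\setminus\{f\}$; otherwise it is essential with respect to $\mathcal B$. An element $f\in\mathfrak I_d$ is strongly inessential (respectively strongly essential) if $f\notin(\mathfrak I_{d-1})S$ and $f$ is inessential (respectively essential) with respect to every standard basis of $\mathfrak I$ containing it. For each degree $d$ let $\nu_e(d)$ (respectively $\mu_e(d)$) be the greatest (respectively smallest) number of essential elements of degree $d$ contained in a standard basis of $\mathfrak I$. A standard basis is e-maximal (respectively e-minimal) if in every degree $d$ it has exactly $\nu_e(d)$ (respectively $\mu_e(d)$) essential elements. *)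

theory Defs
  imports "HOL-Library.Poly_Mapping" "HOL-Computational_Algebra.Polynomial"
begin

text \<open>
  The ring \<open>S = K[y\<^sub>0, \<dots>, y\<^sub>n]\<close>: polynomial mappings from exponent vectors to coefficients. The
  variables are indexed by a finite type with \<open>n + 1\<close> elements.
\<close>

type_synonym ('n, 'k) mpol = "('n \<Rightarrow>\<^sub>0 nat) \<Rightarrow>\<^sub>0 'k"

definition var :: "'n \<Rightarrow> ('n, 'k::comm_ring_1) mpol" where
  "var i = Poly_Mapping.single (Poly_Mapping.single i 1) 1"

definition kscale :: "'k::comm_ring_1 \<Rightarrow> ('n, 'k) mpol \<Rightarrow> ('n, 'k) mpol" where
  "kscale c f = Poly_Mapping.single 0 c * f"

definition mdeg :: "('n::finite \<Rightarrow>\<^sub>0 nat) \<Rightarrow> nat" where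
  "mdeg m = (\<Sum>i\<in>UNIV. Poly_Mapping.lookup m i)"

text \<open>The graded piece \<open>S\<^sub>d\<close>; it contains \<open>0\<close>.\<close>

definition forms :: "nat \<Rightarrow> ('n::finite, 'k::comm_ring_1) mpol set" where
  "forms d = {f. \<forall>m\<in>Poly_Mapping.keys f. mdeg m = d}"

abbreviation ideal_gen :: "'r::comm_ring_1 set \<Rightarrow> 'r set" where
  "ideal_gen \<equiv> module.span (*)"

abbreviation kspan :: "('n, 'k::comm_ring_1) mpol set \<Rightarrow> ('n, 'k) mpol set" where
  "kspan \<equiv> module.span kscale"

definition homogeneous_ideal :: "('n::finite, 'k::comm_ring_1) mpol set \<Rightarrow> bool" where
  "homogeneous_ideal I \<longleftrightarrow> (\<exists>F. F \<subseteq> (\<Union>d. forms d) \<and> I = ideal_gen F)"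

definition irrelevant :: "('n, 'k::comm_ring_1) mpol set" where
  "irrelevant = ideal_gen (var ` UNIV)"

primrec ideal_pow :: "'r::comm_ring_1 set \<Rightarrow> nat \<Rightarrow> 'r set" where
  "ideal_pow J 0 = UNIV"
| "ideal_pow J (Suc t) = ideal_gen {a * b | a b. a \<in> ideal_pow J t \<and> b \<in> J}"

definition saturation :: "('n, 'k::comm_ring_1) mpol set \<Rightarrow> ('n, 'k) mpol set" where
  "saturation I = {f. \<exists>t. \<forall>g\<in>ideal_pow irrelevant t. f * g \<in> I}"

definition graded_part ::
    "('n::finite, 'k::comm_ring_1) mpol set \<Rightarrow> nat \<Rightarrow> ('n, 'k) mpol set" where
  "graded_part I d = I \<inter> forms d"

text \<open>\<open>I\<^bsub>d - 1\<^esub>\<close>, with the convention \<open>I\<^bsub>-1\<^esub> = 0\<close>.\<close>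

definition pred_part ::
    "('n::finite, 'k::comm_ring_1) mpol set \<Rightarrow> nat \<Rightarrow> ('n, 'k) mpol set" where
  "pred_part I d = (case d of 0 \<Rightarrow> {0} | Suc e \<Rightarrow> graded_part I e)"

text \<open>\<open>I\<^bsub>d - 1\<^esub> S\<^sub>1\<close>, a \<open>K\<close>-subspace of \<open>I\<^sub>d\<close>.\<close>

definition lifted_part ::
    "('n::finite, 'k::comm_ring_1) mpol set \<Rightarrow> nat \<Rightarrow> ('n, 'k) mpol set" where
  "lifted_part I d = kspan {g * l | g l. g \<in> pred_part I d \<and> l \<in> forms 1}"

text \<open>
  The classes of the elements of \<open>B\<close> are pairwise distinct and form a \<open>K\<close>-basis of \<open>V / W\<close>: they
  span \<open>V / W\<close> and are linearly independent in it (distinctness follows from independence).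
\<close>

definition quotient_basis ::
    "('n, 'k::comm_ring_1) mpol set \<Rightarrow> ('n, 'k) mpol set \<Rightarrow> ('n, 'k) mpol set \<Rightarrow> bool" where
  "quotient_basis V W B \<longleftrightarrow> finite B \<and> B \<subseteq> V \<and>
     (\<forall>v\<in>V. \<exists>c. v - (\<Sum>b\<in>B. kscale (c b) b) \<in> W) \<and>
     (\<forall>c. (\<Sum>b\<in>B. kscale (c b) b) \<in> W \<longrightarrow> (\<forall>b\<in>B. c b = 0))"

text \<open>
  An ordered set of forms is a list without repetitions. Finiteness is no restriction, since \<open>S\<close> is
  Noetherian. The zero form is excluded by linear independence.
\<close>

definition standard_basis ::
    "('n::finite, 'k::comm_ring_1) mpol set \<Rightarrow> ('n, 'k) mpol list \<Rightarrow> bool" where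
  "standard_basis I bs \<longleftrightarrow> distinct bs \<and> set bs \<subseteq> (\<Union>d. forms d) \<and> ideal_gen (set bs) = I \<and>
     (\<forall>d. quotient_basis (graded_part I d) (lifted_part I d) (set bs \<inter> forms d))"

definition inessential :: "('n, 'k::comm_ring_1) mpol list \<Rightarrow> ('n, 'k) mpol \<Rightarrow> bool" where
  "inessential bs f \<longleftrightarrow> f \<in> set bs \<and> f \<in> saturation (ideal_gen (set bs - {f}))"

definition essential :: "('n, 'k::comm_ring_1) mpol list \<Rightarrow> ('n, 'k) mpol \<Rightarrow> bool" where
  "essential bs f \<longleftrightarrow> f \<in> set bs \<and> f \<notin> saturation (ideal_gen (set bs - {f}))"

definition strongly_inessential ::
    "('n::finite, 'k::comm_ring_1) mpol set \<Rightarrow> ('n, 'k) mpol \<Rightarrow> bool" where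
  "strongly_inessential I f \<longleftrightarrow>
     (\<exists>d. f \<in> graded_part I d \<and> f \<notin> ideal_gen (pred_part I d)) \<and>
     (\<forall>bs. standard_basis I bs \<and> f \<in> set bs \<longrightarrow> inessential bs f)"

definition strongly_essential ::
    "('n::finite, 'k::comm_ring_1) mpol set \<Rightarrow> ('n, 'k) mpol \<Rightarrow> bool" where
  "strongly_essential I f \<longleftrightarrow>
     (\<exists>d. f \<in> graded_part I d \<and> f \<notin> ideal_gen (pred_part I d)) \<and>
     (\<forall>bs. standard_basis I bs \<and> f \<in> set bs \<longrightarrow> essential bs f)"

definition num_essential :: "('n::finite, 'k::comm_ring_1) mpol list \<Rightarrow> nat \<Rightarrow> nat" where
  "num_essential bs d = card {f \<in> set bs. f \<in> forms d \<and> essential bs f}"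

definition nu_e :: "('n::finite, 'k::comm_ring_1) mpol set \<Rightarrow> nat \<Rightarrow> nat" where
  "nu_e I d = (GREATEST k. \<exists>bs. standard_basis I bs \<and> num_essential bs d = k)"

definition mu_e :: "('n::finite, 'k::comm_ring_1) mpol set \<Rightarrow> nat \<Rightarrow> nat" where
  "mu_e I d = (LEAST k. \<exists>bs. standard_basis I bs \<and> num_essential bs d = k)"

definition e_maximal ::
    "('n::finite, 'k::comm_ring_1) mpol set \<Rightarrow> ('n, 'k) mpol list \<Rightarrow> bool" where
  "e_maximal I bs \<longleftrightarrow> standard_basis I bs \<and> (\<forall>d. num_essential bs d = nu_e I d)"

definition e_minimal ::
    "('n::finite, 'k::comm_ring_1) mpol set \<Rightarrow> ('n, 'k) mpol list \<Rightarrow> bool" where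
  "e_minimal I bs \<longleftrightarrow> standard_basis I bs \<and> (\<forall>d. num_essential bs d = mu_e I d)"

end

theory Submission
  imports Defs
begin

text \<open>
  Fix a degree \<open>d\<close>. The elements of degree \<open>d\<close> of a standard basis form a basis of the
  finite-dimensional space \<open>U = I\<^sub>d / (I\<^bsub>d-1\<^esub>S\<^sub>1)\<close>, so their number does not depend on the standard
  basis, and counting essential elements is the same as counting inessential ones. The two halves of
  the theorem are therefore two instances of one statement about a \<^emph>\<open>status\<close> \<open>s\<close>, which
  is either ``essential'' or ``inessential'' (\<open>has_status\<close>): a standard basis has the greatest
  possible number of elements of status \<open>s\<close> in every degree if and only if each of its elements of
  the opposite status has the opposite status in every standard basis that contains it
  (\<open>num_status_maximal_iff\<close>). Both directions are exchange arguments.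

  \<^item> Suppose that \<open>f\<close> has the wrong status in \<open>B\<close> but status \<open>s\<close> in another standard
    basis \<open>C\<close>. Write every other \<open>b\<close> in \<open>B\<close> as \<open>b = h f + j\<close> with \<open>j\<close> in the ideal generated by
    \<open>C - {f}\<close>, and replace \<open>b\<close> by \<open>b - h f\<close>. The new elements other than \<open>f\<close> generate the same
    ideal as \<open>C - {f}\<close> (\<open>ideal_gen_rest_eq\<close>), so \<open>f\<close> now has status \<open>s\<close>. For each \<open>b\<close>, the ideal of
    the remaining elements contains \<open>f\<close> before and after, hence it has not changed, and \<open>b\<close> was
    only changed by an element of it; so the status of \<open>b\<close> is what it was
    (\<open>transplant_status\<close>). The number of elements of status \<open>s\<close> has gone up by one.

  \<^item> Conversely, suppose that the elements of \<open>B\<close> of the wrong status are strongly so, and let \<open>C\<close> be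
    any standard basis. Expand such an \<open>f\<close> in the basis of \<open>U\<close> given by \<open>C\<close>. If some \<open>b\<close> of
    status \<open>s\<close> occurred with nonzero coefficient, then replacing \<open>b\<close> by \<open>f\<close> in \<open>C\<close> would give a
    standard basis in which \<open>f\<close> inherits the status of \<open>b\<close> (\<open>replace_one\<close>), which is excluded.
    So in \<open>U\<close> the wrong-status elements of \<open>B\<close> lie in the span of those of \<open>C\<close>; as they are
    independent, \<open>C\<close> has at least as many of them (\<open>num_status_maximal\<close>).

  That the modified lists are again standard bases follows from a dimension count, a graded form of
  Nakayama's lemma (\<open>standard_basis_map\<close>): replacing each element by a form of the same degree
  gives a standard basis as soon as the new forms still generate \<open>I\<close>.
\<close>

section \<open>Linear independence modulo a subspace\<close>

text \<open>
  Linear independence in the quotient by \<open>W\<close>, expressed with representatives so that no quotient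
  space has to be built.
\<close>
definition (in vector_space) independent_mod :: "'b set \<Rightarrow> 'b set \<Rightarrow> bool" where
  "independent_mod W E \<longleftrightarrow> (\<forall>c. (\<Sum>b\<in>E. c b *s b) \<in> W \<longrightarrow> (\<forall>b\<in>E. c b = 0))"

context vector_space
begin

lemma independent_mod_coeff_zero:
  assumes "finite E" "independent_mod W E" "b \<in> E" "u \<in> span (E - {b})" "k *s b - u \<in> W"
  shows "k = 0"
proof -
  obtain r where r: "u = (\<Sum>x\<in>E - {b}. r x *s x)"
    using assms(1,4) span_finite[of "E - {b}"] by auto
  let ?c = "\<lambda>x. if x = b then k else - r x"
  have "(\<Sum>x\<in>E. ?c x *s x) = k *s b + (\<Sum>x\<in>E - {b}. (- r x) *s x)"
    using assms(1,3) by (subst sum.remove[of E b]) (auto intro!: sum.cong)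
  also have "\<dots> = k *s b - u"
    by (simp add: r sum_negf)
  finally have "(\<Sum>x\<in>E. ?c x *s x) \<in> W"
    using assms(5) by simp
  then have "?c b = 0"
    using assms(2)[unfolded independent_mod_def, THEN spec, of ?c] assms(3) by blast
  then show ?thesis
    by simp
qed

lemma independent_mod_mono:
  assumes "finite E" "independent_mod W E" "E' \<subseteq> E"
  shows "independent_mod W E'"
  unfolding independent_mod_def
proof (intro allI impI)
  fix c
  assume c: "(\<Sum>b\<in>E'. c b *s b) \<in> W"
  let ?c = "\<lambda>b. if b \<in> E' then c b else 0"
  have "(\<Sum>b\<in>E. ?c b *s b) = (\<Sum>b\<in>E'. c b *s b)"
    using assms(1,3) by (intro sum.mono_neutral_cong_right) auto
  then have "\<forall>b\<in>E. ?c b = 0"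
    using assms(2)[unfolded independent_mod_def, THEN spec, of ?c] c by simp
  then show "\<forall>b\<in>E'. c b = 0"
    using assms(3) by (metis subsetD)
qed

lemma independent_mod_span_zero:
  assumes "finite E" "independent_mod W E" "u \<in> span E" "u \<in> W"
  shows "u = 0"
proof -
  obtain r where r: "u = (\<Sum>x\<in>E. r x *s x)"
    using assms(1,3) span_finite[of E] by auto
  then have "\<forall>x\<in>E. r x = 0"
    using assms(2,4) unfolding independent_mod_def by blast
  then show ?thesis
    by (simp add: r)
qed

text \<open>
  Steinitz' bound in the quotient by \<open>W\<close>. Only finitely many vectors of \<open>W\<close> occur as differences
  \<open>v - u\<close>; a basis \<open>D\<close> of their span stays independent when it is joined to \<open>E\<close>, and \<open>E \<union> D\<close> lies
  in the span of \<open>T \<union> D\<close>. The usual bound for these finite sets has \<open>card D\<close> on both sides.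
\<close>
lemma card_le_if_independent_mod:
  assumes fin: "finite T" "finite E" and W: "subspace W" and ind: "independent_mod W E"
    and sp: "\<And>v. v \<in> E \<Longrightarrow> \<exists>u\<in>span T. v - u \<in> W"
  shows "card E \<le> card T"
proof -
  obtain u where u: "\<And>v. v \<in> E \<Longrightarrow> u v \<in> span T" "\<And>v. v \<in> E \<Longrightarrow> v - u v \<in> W"
    using sp by metis
  define W0 where "W0 = (\<lambda>v. v - u v) ` E"
  obtain D where D: "D \<subseteq> W0" "independent D" "W0 \<subseteq> span D"
    using maximal_independent_subset[of W0] by blast
  have finD: "finite D"
    using D(1) fin(2) by (auto simp: W0_def intro: finite_subset)
  have DW: "D \<subseteq> W"
    using D(1) u(2) by (auto simp: W0_def)
  have disj: "E \<inter> D = {}"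
  proof (rule ccontr)
    assume "E \<inter> D \<noteq> {}"
    then obtain b where "b \<in> E" "b \<in> W"
      using DW by blast
    then show False
      using independent_mod_coeff_zero[OF fin(2) ind, of b 0 1] by (simp add: span_zero)
  qed
  have "independent (E \<union> D)"
  proof (rule independent_if_scalars_zero)
    fix f x
    assume "(\<Sum>x\<in>E \<union> D. f x *s x) = 0" and x: "x \<in> E \<union> D"
    then have 0: "(\<Sum>x\<in>E. f x *s x) + (\<Sum>x\<in>D. f x *s x) = 0"
      by (simp add: sum.union_disjoint fin finD disj)
    have "(\<Sum>x\<in>D. f x *s x) \<in> W"
      using DW by (intro subspace_sum[OF W] subspace_scale[OF W]) auto
    moreover have "(\<Sum>x\<in>E. f x *s x) = - (\<Sum>x\<in>D. f x *s x)"
      using 0 by (rule add_eq_0_iff2[THEN iffD1])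
    ultimately have "(\<Sum>x\<in>E. f x *s x) \<in> W"
      using subspace_neg[OF W] by simp
    then have E0: "\<forall>x\<in>E. f x = 0"
      using ind unfolding independent_mod_def by blast
    then have "(\<Sum>x\<in>D. f x *s x) = 0"
      using 0 by simp
    then have "\<forall>x\<in>D. f x = 0"
      using D(2) finD dependent_finite by blast
    then show "f x = 0"
      using E0 x by blast
  qed (use fin finD in auto)
  moreover have "E \<union> D \<subseteq> span (T \<union> D)"
  proof -
    have "v \<in> span (T \<union> D)" if "v \<in> E" for v
    proof -
      have "u v \<in> span (T \<union> D)"
        using u(1)[OF that] span_mono[of T "T \<union> D"] by auto
      moreover have "v - u v \<in> span (T \<union> D)"
        using D(3) that span_mono[of D "T \<union> D"] by (auto simp: W0_def)
      ultimately show ?thesis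
        using span_add by fastforce
    qed
    then show ?thesis
      using span_superset[of "T \<union> D"] by blast
  qed
  ultimately have "card (E \<union> D) \<le> card (T \<union> D)"
    using independent_span_bound[of "T \<union> D"] fin finD by auto
  then show ?thesis
    using card_Un_le[of T D] card_Un_disjoint[OF fin(2) finD disj] by simp
qed

text \<open>
  In the quotient, a spanning set no larger than an independent set is a basis: a dependent
  element could be dropped from it, leaving too few elements to span.
\<close>
lemma independent_mod_if_spanning:
  assumes fin: "finite T" "finite E" and W: "subspace W" and ind: "independent_mod W E"
    and sp: "\<And>v. v \<in> E \<Longrightarrow> \<exists>u\<in>span T. v - u \<in> W" and card: "card T \<le> card E"
  shows "independent_mod W T"
  unfolding independent_mod_def
proof (intro allI impI ballI, rule ccontr)
  fix c t
  assume c: "(\<Sum>b\<in>T. c b *s b) \<in> W" and t: "t \<in> T" and ct: "c t \<noteq> 0"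
  define s where "s = - (\<Sum>b\<in>T - {t}. (c b / c t) *s b)"
  have s: "s \<in> span (T - {t})"
    unfolding s_def by (rule span_neg, rule span_sum, rule span_scale, rule span_base)
  have "(\<Sum>b\<in>T. c b *s b) = c t *s t + (\<Sum>b\<in>T - {t}. c b *s b)"
    using fin(1) t by (rule sum.remove)
  moreover have "c t *s s = - (\<Sum>b\<in>T - {t}. c b *s b)"
    using ct by (simp add: s_def scale_sum_right)
  ultimately have "(\<Sum>b\<in>T. c b *s b) = c t *s (t - s)"
    by (simp add: scale_right_diff_distrib)
  then have "t - s = (1 / c t) *s (\<Sum>b\<in>T. c b *s b)"
    using ct by simp
  then have ts: "t - s \<in> W"
    using c W subspace_scale by simp
  have "\<exists>u\<in>span (T - {t}). v - u \<in> W" if v: "v \<in> E" for v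
  proof -
    obtain u where u: "u \<in> span T" "v - u \<in> W"
      using sp[OF v] by blast
    obtain k where k: "u - k *s t \<in> span (T - {t})"
      using span_breakdown[OF t u(1)] by blast
    have "v - ((u - k *s t) + k *s s) = (v - u) + k *s (t - s)"
      by (simp add: scale_right_diff_distrib)
    also have "\<dots> \<in> W"
      by (intro subspace_add[OF W u(2)] subspace_scale[OF W ts])
    finally have "v - ((u - k *s t) + k *s s) \<in> W" .
    then show ?thesis
      using span_add[OF k span_scale[OF s]] by blast
  qed
  then have "card E \<le> card (T - {t})"
    using card_le_if_independent_mod[OF _ fin(2) W ind] fin(1) by blast
  moreover have "card (T - {t}) < card T"
    using fin(1) t by (rule card_Diff1_less)
  ultimately show False
    using card by linarith
qed

end

section \<open>Homogeneous components\<close>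

interpretation ideal: module "(*) :: 'r::comm_ring_1 \<Rightarrow> 'r \<Rightarrow> 'r"
  by unfold_locales (simp_all add: algebra_simps)

interpretation kvs: vector_space "kscale :: 'k::field \<Rightarrow> ('n, 'k) mpol \<Rightarrow> ('n, 'k) mpol"
proof unfold_locales
  fix a b :: 'k and x :: "('n, 'k) mpol"
  show "kscale a (kscale b x) = kscale (a * b) x"
    by (simp add: kscale_def mult_single flip: mult.assoc)
qed (simp_all add: kscale_def distrib_left distrib_right single_add)

definition hcomp :: "nat \<Rightarrow> ('n::finite, 'k::comm_ring_1) mpol \<Rightarrow> ('n, 'k) mpol" where
  "hcomp d = Poly_Mapping.mapp (\<lambda>m c. c when mdeg m = d)"

lemma lookup_hcomp:
  "Poly_Mapping.lookup (hcomp d f) m = (Poly_Mapping.lookup f m when mdeg m = d)"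
  by (simp add: hcomp_def lookup_mapp when_def in_keys_iff)

lemma hcomp_add: "hcomp d (f + g) = hcomp d f + hcomp d g"
  by (rule poly_mapping_eqI) (simp add: lookup_hcomp lookup_add when_def)

lemma hcomp_0 [simp]: "hcomp d 0 = 0"
  by (rule poly_mapping_eqI) (simp add: lookup_hcomp)

lemma hcomp_sum: "hcomp d (sum F A) = (\<Sum>a\<in>A. hcomp d (F a))"
  by (induction A rule: infinite_finite_induct) (simp_all add: hcomp_add)

lemma hcomp_in_forms: "hcomp d f \<in> forms d"
  by (auto simp: forms_def in_keys_iff lookup_hcomp when_def split: if_splits)

lemma hcomp_of_form: "f \<in> forms e \<Longrightarrow> hcomp d f = (if d = e then f else 0)"
  by (rule poly_mapping_eqI) (auto simp: lookup_hcomp forms_def in_keys_iff when_def)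

lemma form_degree_unique: "f \<in> forms d \<Longrightarrow> f \<in> forms e \<Longrightarrow> f \<noteq> 0 \<Longrightarrow> d = e"
  by (metis hcomp_of_form)

lemma sum_hcomp: "f = (\<Sum>e\<in>mdeg ` Poly_Mapping.keys f. hcomp e f)"
  by (rule poly_mapping_eqI) (auto simp: lookup_sum lookup_hcomp when_def in_keys_iff)

lemma forms_diff: "f \<in> forms d \<Longrightarrow> g \<in> forms d \<Longrightarrow> f - g \<in> forms d"
  by (auto simp: forms_def in_keys_iff lookup_minus)

lemma mdeg_add: "mdeg (m + m') = mdeg m + mdeg m'"
  by (simp add: mdeg_def lookup_add sum.distrib)

lemma forms_mult: "f \<in> forms d \<Longrightarrow> g \<in> forms e \<Longrightarrow> f * g \<in> forms (d + e)"
  using keys_mult[of f g] by (fastforce simp: forms_def mdeg_add)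

lemma mdeg_eq_0_iff: "mdeg m = 0 \<longleftrightarrow> m = 0"
  by (auto simp: mdeg_def intro: poly_mapping_eqI)

lemma form_0_scalar:
  assumes "q \<in> forms 0"
  shows "q * f = kscale (Poly_Mapping.lookup q 0) f"
proof -
  have "q = Poly_Mapping.single 0 (Poly_Mapping.lookup q 0)"
    using assms by (intro poly_mapping_eqI)
      (auto simp: forms_def mdeg_eq_0_iff lookup_single when_def in_keys_iff)
  then show ?thesis
    unfolding kscale_def by simp
qed

lemma hcomp_form_mult:
  assumes "f \<in> forms a"
  shows "hcomp d (f * g) = (if a \<le> d then f * hcomp (d - a) g else 0)"
proof -
  let ?E = "mdeg ` Poly_Mapping.keys g"
  have "hcomp d (f * g) = (\<Sum>e\<in>?E. hcomp d (f * hcomp e g))"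
    by (subst sum_hcomp[of g]) (simp add: sum_distrib_left hcomp_sum)
  also have "\<dots> = (\<Sum>e\<in>?E. if d = a + e then f * hcomp e g else 0)"
    using forms_mult[OF assms hcomp_in_forms] by (intro sum.cong refl hcomp_of_form) auto
  also have "\<dots> = (if a \<le> d then (\<Sum>e\<in>?E. if d - a = e then f * hcomp e g else 0) else 0)"
  proof (cases "a \<le> d")
    case True
    then have "d = a + e \<longleftrightarrow> d - a = e" for e
      by auto
    then show ?thesis
      using True by simp
  qed (auto intro!: sum.neutral)
  also have "\<dots> = (if a \<le> d then f * hcomp (d - a) g else 0)"
  proof -
    have "hcomp (d - a) g = 0" if "d - a \<notin> ?E"
      using that by (intro poly_mapping_eqI) (force simp: lookup_hcomp when_def in_keys_iff)
    then show ?thesis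
      by (auto simp: sum.delta')
  qed
  finally show ?thesis .
qed

lemma ideal_gen_hcomp:
  assumes Y: "Y \<subseteq> (\<Union>d. forms d)" and "v \<in> ideal_gen Y"
  shows "hcomp e v \<in> ideal_gen Y"
  using assms(2)
proof (induction v rule: ideal.span_induct_alt)
  case base
  show ?case
    by (simp add: ideal.span_zero)
next
  case (step c y v)
  obtain a where "y \<in> forms a"
    using Y step by blast
  then have "hcomp e (c * y) = (if a \<le> e then hcomp (e - a) c * y else 0)"
    using hcomp_form_mult[of y a e c] by (simp add: mult.commute)
  then have "hcomp e (c * y) \<in> ideal_gen Y"
    using step by (simp add: ideal.span_scale ideal.span_base ideal.span_zero)
  then show ?case
    using step by (simp add: hcomp_add ideal.span_add)
qed

text \<open>
  Extracting the component of degree \<open>e\<close> from any representation of \<open>v\<close> makes the coefficient of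
  \<open>f\<close> homogeneous. The point is the last clause: below the degree of \<open>f\<close> the generator \<open>f\<close>
  contributes nothing, and in the degree of \<open>f\<close> it contributes only a scalar multiple.
\<close>
lemma ideal_gen_insert_split:
  assumes f: "f \<in> forms d" and Y: "Y \<subseteq> (\<Union>d. forms d)"
    and v: "v \<in> ideal_gen (insert f Y)" "v \<in> forms e"
  obtains q j where "v = q * f + j" "j \<in> ideal_gen Y" "j \<in> forms e"
    "if d \<le> e then q \<in> forms (e - d) else q = 0"
proof -
  obtain k where k: "v - k * f \<in> ideal_gen Y"
    using v(1) ideal.span_breakdown_eq by blast
  define q where "q = (if d \<le> e then hcomp (e - d) k else 0)"
  have "v = hcomp e (f * k + (v - k * f))"
    using v(2) by (simp add: hcomp_of_form mult.commute)
  also have "\<dots> = q * f + hcomp e (v - k * f)"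
    unfolding hcomp_add hcomp_form_mult[OF f] q_def by (simp add: mult.commute)
  finally have "v = q * f + hcomp e (v - k * f)" .
  moreover have "if d \<le> e then q \<in> forms (e - d) else q = 0"
    by (simp add: q_def hcomp_in_forms)
  ultimately show ?thesis
    using that ideal_gen_hcomp[OF Y k] hcomp_in_forms by blast
qed

section \<open>The graded pieces of an ideal generated by forms\<close>

lemma kscale_in_ideal: "v \<in> ideal_gen Y \<Longrightarrow> kscale c v \<in> ideal_gen Y"
  unfolding kscale_def by (rule ideal.span_scale)

lemma kspan_subset_ideal_gen:
  assumes "A \<subseteq> ideal_gen Y"
  shows "kspan A \<subseteq> ideal_gen (Y :: ('n, 'k::field) mpol set)"
  by (rule kvs.span_minimal[OF assms], rule kvs.subspaceI)
    (auto intro: ideal.span_zero ideal.span_add kscale_in_ideal)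

lemma subspace_lifted_part: "kvs.subspace (lifted_part J d)"
  unfolding lifted_part_def by (rule kvs.subspace_span)

lemma lifted_part_mono:
  "J \<subseteq> J' \<Longrightarrow> lifted_part J d \<subseteq> lifted_part (J' :: ('n::finite, 'k::field) mpol set) d"
  unfolding lifted_part_def
  by (rule kvs.span_mono) (auto simp: pred_part_def graded_part_def split: nat.splits)

lemma var_in_forms: "var i \<in> forms 1"
  by (auto simp: var_def forms_def mdeg_def lookup_single when_def)

text \<open>
  Each monomial of \<open>s\<close> has a variable as a factor. Splitting it off writes the monomial times \<open>y\<close>
  as a product of an element of the ideal of degree one less and a linear form.
\<close>
lemma mult_form_in_lifted_part:
  fixes Y :: "('n::finite, 'k::field) mpol set"
  assumes y: "y \<in> ideal_gen Y" "y \<in> forms a" and s: "s \<in> forms k" and k: "0 < k"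
  shows "s * y \<in> lifted_part (ideal_gen Y) (a + k)"
proof -
  let ?c = "Poly_Mapping.lookup s"
  have "s = (\<Sum>m\<in>Poly_Mapping.keys s. Poly_Mapping.single m (?c m))"
    by (rule poly_mapping_eqI) (auto simp: lookup_sum lookup_single when_def in_keys_iff)
  then have "s * y = (\<Sum>m\<in>Poly_Mapping.keys s. Poly_Mapping.single m (?c m) * y)"
    using sum_distrib_right by metis
  moreover have "Poly_Mapping.single m (?c m) * y \<in> lifted_part (ideal_gen Y) (a + k)"
    if m: "m \<in> Poly_Mapping.keys s" for m
  proof -
    have deg: "mdeg m = k"
      using s m by (auto simp: forms_def)
    then have "\<exists>i. Poly_Mapping.lookup m i \<noteq> 0"
      using k by (metis gr0I mdeg_def not_less0 sum.neutral)
    then obtain i where i: "0 < Poly_Mapping.lookup m i"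
      by auto
    define m' where "m' = m - Poly_Mapping.single i 1"
    have mm': "m = m' + Poly_Mapping.single i 1"
      using i by (intro poly_mapping_eqI)
        (auto simp: m'_def lookup_add lookup_minus lookup_single when_def)
    have "mdeg (Poly_Mapping.single i 1) = 1"
      by (simp add: mdeg_def lookup_single when_def)
    then have deg': "mdeg m' = k - 1"
      using deg mm' by (simp add: mdeg_add)
    define g where "g = Poly_Mapping.single m' (?c m) * y"
    have "Poly_Mapping.single m (?c m) = Poly_Mapping.single m' (?c m) * var i"
      using mm' by (simp add: var_def mult_single)
    then have "Poly_Mapping.single m (?c m) * y = g * var i"
      by (simp only: g_def ac_simps)
    moreover have "g \<in> pred_part (ideal_gen Y) (a + k)"
    proof -
      have "Poly_Mapping.single m' (?c m) \<in> forms (k - 1)"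
        using deg' by (auto simp: forms_def)
      then have "g \<in> forms (k - 1 + a)"
        unfolding g_def using y(2) by (rule forms_mult)
      moreover have "pred_part (ideal_gen Y) (a + k) = graded_part (ideal_gen Y) (k - 1 + a)"
        using k by (cases k) (simp_all add: pred_part_def add.commute)
      ultimately show ?thesis
        using y(1) by (simp add: graded_part_def g_def ideal.span_scale)
    qed
    ultimately show ?thesis
      unfolding lifted_part_def using var_in_forms by (auto intro!: kvs.span_base)
  qed
  ultimately show ?thesis
    by (simp add: kvs.subspace_sum subspace_lifted_part)
qed

text \<open>
  The graded piece \<open>J\<^sub>e\<close> of an ideal \<open>J\<close> generated by forms is spanned modulo \<open>J\<^bsub>e-1\<^esub>S\<^sub>1\<close> by the
  generators of degree \<open>e\<close>. In a product of a coefficient and a generator of degree \<open>a\<close>, the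
  component of degree \<open>e\<close> vanishes if \<open>e < a\<close>, is a scalar multiple of the generator if \<open>e = a\<close>, and
  lies in \<open>J\<^bsub>e-1\<^esub>S\<^sub>1\<close> if \<open>e > a\<close>.
\<close>
lemma ideal_gen_graded_decomposition:
  fixes Y :: "('n::finite, 'k::field) mpol set"
  assumes Y: "Y \<subseteq> (\<Union>d. forms d)" and v: "v \<in> ideal_gen Y" "v \<in> forms e"
  shows "\<exists>u\<in>kspan (Y \<inter> forms e). v - u \<in> lifted_part (ideal_gen Y) e"
proof -
  let ?L = "lifted_part (ideal_gen Y) e"
  have "\<exists>u\<in>kspan (Y \<inter> forms e). hcomp e v - u \<in> ?L"
    using v(1)
  proof (induction v rule: ideal.span_induct_alt)
    case base
    show ?case
      using kvs.span_zero kvs.subspace_0[OF subspace_lifted_part] by force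
  next
    case (step c y v)
    obtain u where u: "u \<in> kspan (Y \<inter> forms e)" "hcomp e v - u \<in> ?L"
      using step by blast
    obtain a where a: "y \<in> forms a"
      using Y step by blast
    have *: "hcomp e (c * y) = (if a \<le> e then hcomp (e - a) c * y else 0)"
      using hcomp_form_mult[OF a, of e c] by (simp add: mult.commute)
    have "\<exists>w\<in>kspan (Y \<inter> forms e). hcomp e (c * y) - w \<in> ?L"
    proof (cases "a = e")
      case True
      then have "hcomp e (c * y) = kscale (Poly_Mapping.lookup (hcomp 0 c) 0) y"
        using * form_0_scalar[OF hcomp_in_forms] by simp
      then have "hcomp e (c * y) \<in> kspan (Y \<inter> forms e)"
        using step a True by (simp add: kvs.span_scale kvs.span_base)
      then show ?thesis
        using kvs.subspace_0[OF subspace_lifted_part] by force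
    next
      case False
      have "hcomp e (c * y) \<in> ?L"
      proof (cases "a < e")
        case True
        then have "hcomp (e - a) c * y \<in> lifted_part (ideal_gen Y) (a + (e - a))"
          using step a by (intro mult_form_in_lifted_part hcomp_in_forms ideal.span_base) auto
        then show ?thesis
          using * True by simp
      qed (use * False in \<open>simp add: kvs.subspace_0[OF subspace_lifted_part]\<close>)
      then show ?thesis
        using kvs.span_zero by force
    qed
    then obtain w where w: "w \<in> kspan (Y \<inter> forms e)" "hcomp e (c * y) - w \<in> ?L"
      by blast
    have "hcomp e (c * y + v) - (w + u) = (hcomp e (c * y) - w) + (hcomp e v - u)"
      by (simp add: hcomp_add)
    also have "\<dots> \<in> ?L"
      using kvs.subspace_add[OF subspace_lifted_part w(2) u(2)] .
    finally show ?case
      using kvs.span_add[OF w(1) u(1)] by blast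
  qed
  then show ?thesis
    using v(2) by (simp add: hcomp_of_form)
qed

section \<open>Standard bases\<close>

lemma quotient_basis_iff:
  "quotient_basis V W (B :: ('n, 'k::field) mpol set) \<longleftrightarrow>
     finite B \<and> B \<subseteq> V \<and> (\<forall>v\<in>V. \<exists>u\<in>kspan B. v - u \<in> W) \<and> kvs.independent_mod W B"
  unfolding quotient_basis_def kvs.independent_mod_def
  by (auto simp: kvs.span_finite)

lemma standard_basisD:
  fixes I :: "('n::finite, 'k::field) mpol set"
  assumes "standard_basis I B"
  shows "set B \<subseteq> (\<Union>d. forms d)" "ideal_gen (set B) = I"
    "kvs.independent_mod (lifted_part I d) (set B \<inter> forms d)"
    "v \<in> I \<Longrightarrow> v \<in> forms d \<Longrightarrow> \<exists>u\<in>kspan (set B \<inter> forms d). v - u \<in> lifted_part I d"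
    "distinct B"
  using assms unfolding standard_basis_def quotient_basis_iff graded_part_def by auto

text \<open>
  A graded form of Nakayama's lemma. Because \<open>g\<close> respects degrees, in each degree there are at most
  as many nonzero new generators as old ones; because they generate \<open>I\<close>, they span
  \<open>I\<^sub>e / (I\<^bsub>e-1\<^esub>S\<^sub>1)\<close>, whose dimension is the number of old ones. Equality of these numbers forces all
  the rest: \<open>g\<close> identifies no two elements, sends none to \<open>0\<close>, and the new elements are
  independent. The form \<open>0\<close> needs separate care since it has every degree.
\<close>
lemma standard_basis_map:
  fixes I :: "('n::finite, 'k::field) mpol set"
  assumes B: "standard_basis I B"
    and deg: "\<And>b e. b \<in> set B \<Longrightarrow> b \<in> forms e \<Longrightarrow> g b \<in> forms e"
    and gen: "ideal_gen (g ` set B) = I"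
  shows "standard_basis I (map g B)" "inj_on g (set B)"
    "\<And>e. g ` set B \<inter> forms e = g ` (set B \<inter> forms e)"
proof -
  have forms: "g ` set B \<subseteq> (\<Union>d. forms d)"
  proof safe
    fix b
    assume b: "b \<in> set B"
    then obtain e where "b \<in> forms e"
      using standard_basisD(1)[OF B] by blast
    then show "g b \<in> (\<Union>d. forms d)"
      using deg[OF b] by blast
  qed
  have sub: "g ` set B \<inter> forms e - {0} \<subseteq> g ` (set B \<inter> forms e) - {0}" for e
  proof
    fix y
    assume y: "y \<in> g ` set B \<inter> forms e - {0}"
    then obtain b a where b: "b \<in> set B" "y = g b" "b \<in> forms a"
      using standard_basisD(1)[OF B] by blast
    then have "a = e"
      using y deg form_degree_unique by blast
    then show "y \<in> g ` (set B \<inter> forms e) - {0}"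
      using y b by blast
  qed
  have span: "\<exists>u\<in>kspan (g ` (set B \<inter> forms e) - {0}). v - u \<in> lifted_part I e"
    if "v \<in> I" "v \<in> forms e" for v e
    using ideal_gen_graded_decomposition[OF forms, of v e] kvs.span_mono[OF sub[of e]] that
    by (auto simp: gen)
  have card: "card (set B \<inter> forms e) \<le> card (g ` (set B \<inter> forms e) - {0})" for e
  proof (rule kvs.card_le_if_independent_mod[OF _ _ subspace_lifted_part standard_basisD(3)[OF B]])
    fix v
    assume "v \<in> set B \<inter> forms e"
    then show "\<exists>u\<in>kspan (g ` (set B \<inter> forms e) - {0}). v - u \<in> lifted_part I e"
      using span standard_basisD(2)[OF B] ideal.span_base by blast
  qed auto
  have le: "card (g ` (set B \<inter> forms e)) \<le> card (set B \<inter> forms e)" for e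
    by (rule card_image_le) simp
  \<comment> \<open>If \<open>0\<close> were a value, the nonzero values would be too few.\<close>
  have nz: "0 \<notin> g ` (set B \<inter> forms e)" for e
  proof
    assume "0 \<in> g ` (set B \<inter> forms e)"
    then have "card (g ` (set B \<inter> forms e) - {0}) < card (g ` (set B \<inter> forms e))"
      by (intro card_Diff1_less) auto
    then show False
      using card[of e] le[of e] by linarith
  qed
  have inj: "inj_on g (set B \<inter> forms e)" for e
    using card[of e] le[of e] nz[of e] by (intro eq_card_imp_inj_on) auto
  have nz': "g b \<noteq> 0" if "b \<in> set B" for b
  proof -
    obtain a where "b \<in> forms a"
      using standard_basisD(1)[OF B] \<open>b \<in> set B\<close> by blast
    then have "g b \<in> g ` (set B \<inter> forms a)"
      using that by blast
    then show ?thesis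
      using nz[of a] by auto
  qed
  show *: "g ` set B \<inter> forms e = g ` (set B \<inter> forms e)" for e
  proof
    show "g ` set B \<inter> forms e \<subseteq> g ` (set B \<inter> forms e)"
      using sub[of e] nz' by fastforce
    show "g ` (set B \<inter> forms e) \<subseteq> g ` set B \<inter> forms e"
      using deg by blast
  qed
  show injB: "inj_on g (set B)"
  proof (rule inj_onI)
    fix b b'
    assume b: "b \<in> set B" "b' \<in> set B" "g b = g b'"
    then obtain a a' where a: "b \<in> forms a" "b' \<in> forms a'"
      using standard_basisD(1)[OF B] by blast
    then have "a = a'"
      using form_degree_unique[OF deg[OF b(1) a(1)] _ nz'[OF b(1)]] deg[OF b(2) a(2)] b(3)
      by simp
    then show "b = b'"
      using inj[of a] b a by (auto dest: inj_onD)
  qed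
  have "quotient_basis (graded_part I e) (lifted_part I e) (g ` (set B \<inter> forms e))" for e
    unfolding quotient_basis_iff
  proof (intro conjI)
    show "g ` (set B \<inter> forms e) \<subseteq> graded_part I e"
      using deg gen ideal.span_base[of _ "g ` set B"] unfolding graded_part_def by blast
    show "\<forall>v\<in>graded_part I e. \<exists>u\<in>kspan (g ` (set B \<inter> forms e)). v - u \<in> lifted_part I e"
      using span[of _ e] nz[of e] by (simp add: graded_part_def)
    show "kvs.independent_mod (lifted_part I e) (g ` (set B \<inter> forms e))"
    proof (rule kvs.independent_mod_if_spanning[OF _ _ subspace_lifted_part
          standard_basisD(3)[OF B] _ le])
      fix v
      assume "v \<in> set B \<inter> forms e"
      then show "\<exists>u\<in>kspan (g ` (set B \<inter> forms e)). v - u \<in> lifted_part I e"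
        using span[of v e] nz[of e] standard_basisD(2)[OF B] ideal.span_base by auto
    qed auto
  qed simp
  then show "standard_basis I (map g B)"
    unfolding standard_basis_def
    using * injB forms gen standard_basisD(5)[OF B] by (simp add: distinct_map)
qed

lemma standard_basis_card_unique:
  fixes I :: "('n::finite, 'k::field) mpol set"
  assumes "standard_basis I B" "standard_basis I B'"
  shows "card (set B \<inter> forms d) = card (set B' \<inter> forms d)"
proof -
  have "card (set B1 \<inter> forms d) \<le> card (set B2 \<inter> forms d)"
    if B: "standard_basis I B1" "standard_basis I B2" for B1 B2
  proof (rule kvs.card_le_if_independent_mod[OF _ _ subspace_lifted_part standard_basisD(3)[OF B(1)]])
    fix v
    assume "v \<in> set B1 \<inter> forms d"
    then show "\<exists>u\<in>kspan (set B2 \<inter> forms d). v - u \<in> lifted_part I d"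
      using standard_basisD(2)[OF B(1)] standard_basisD(4)[OF B(2)] ideal.span_base by blast
  qed auto
  then show ?thesis
    using assms by (simp add: le_antisym)
qed

text \<open>
  Independence in the shape in which the exchange arguments use it: no nonzero multiple of a basis
  element is a combination of the other basis elements of its degree modulo \<open>I\<^bsub>d-1\<^esub>S\<^sub>1\<close>.
\<close>
lemma in_span_rest_lifted_zero:
  fixes I :: "('n::finite, 'k::field) mpol set"
  assumes B: "standard_basis I B" and b: "b \<in> set B" "b \<in> forms d"
    and "u \<in> kspan ((set B - {b}) \<inter> forms d)" "kscale k b - u \<in> lifted_part I d"
  shows "k = 0"
proof (rule kvs.independent_mod_coeff_zero[OF _ standard_basisD(3)[OF B]])
  show "u \<in> kspan (set B \<inter> forms d - {b})"
    using assms(4) by (simp add: Int_Diff Int_commute)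
qed (use assms in auto)

text \<open>
  In degrees below that of \<open>b\<close> the ideal is generated without \<open>b\<close>.
\<close>
lemma lifted_part_subset_rest:
  fixes I :: "('n::finite, 'k::field) mpol set"
  assumes B: "standard_basis I B" and b: "b \<in> set B" "b \<in> forms d"
  shows "lifted_part I d \<subseteq> ideal_gen (set B - {b})"
  unfolding lifted_part_def
proof (rule kspan_subset_ideal_gen, safe)
  fix g l :: "('n, 'k) mpol"
  assume g: "g \<in> pred_part I d"
  have "g \<in> ideal_gen (set B - {b})"
  proof (cases d)
    case 0
    then show ?thesis
      using g by (simp add: pred_part_def ideal.span_zero)
  next
    case (Suc e)
    then have "g \<in> ideal_gen (insert b (set B - {b}))" "g \<in> forms e"
      using g b standard_basisD(2)[OF B] by (auto simp: pred_part_def graded_part_def insert_absorb)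
    then obtain q j where "g = q * b + j" "j \<in> ideal_gen (set B - {b})"
      "if d \<le> e then q \<in> forms (e - d) else q = 0"
      using ideal_gen_insert_split[OF b(2), of "set B - {b}" g e] standard_basisD(1)[OF B] by blast
    then show ?thesis
      using Suc by simp
  qed
  then show "g * l \<in> ideal_gen (set B - {b})"
    using ideal.span_scale[of g _ l] by (simp add: mult.commute)
qed

text \<open>
  In degree \<open>d\<close> the ideal generated by \<open>I\<^bsub>d-1\<^esub>\<close> is just \<open>I\<^bsub>d-1\<^esub>S\<^sub>1\<close>, and there the
  class of a basis element is nonzero.
\<close>
lemma standard_basis_not_generated_below:
  fixes I :: "('n::finite, 'k::field) mpol set"
  assumes B: "standard_basis I B" and b: "b \<in> set B" "b \<in> forms d"
  shows "b \<notin> ideal_gen (pred_part I d)"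
proof
  assume *: "b \<in> ideal_gen (pred_part I d)"
  have I: "ideal_gen I = I"
    using standard_basisD(2)[OF B] ideal.span_span by blast
  have "b \<in> lifted_part I d"
  proof (cases d)
    case 0
    then have "b = 0"
      using * by (auto simp: pred_part_def ideal.span_singleton)
    then show ?thesis
      by (simp add: kvs.subspace_0[OF subspace_lifted_part])
  next
    case (Suc e)
    let ?P = "pred_part I d"
    have P: "?P \<subseteq> forms e" "?P \<subseteq> I"
      by (auto simp: Suc pred_part_def graded_part_def)
    obtain u where u: "u \<in> kspan (?P \<inter> forms d)" "b - u \<in> lifted_part (ideal_gen ?P) d"
      using ideal_gen_graded_decomposition[OF _ * b(2)] P(1) by blast
    have "?P \<inter> forms d \<subseteq> {0}"
      using P(1) Suc form_degree_unique by fastforce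
    then have "u = 0"
      using u(1) kvs.span_mono[of _ "{0}"] by auto
    moreover have "lifted_part (ideal_gen ?P) d \<subseteq> lifted_part I d"
      using ideal.span_mono[OF P(2)] by (intro lifted_part_mono) (simp add: I)
    ultimately show ?thesis
      using u(2) by auto
  qed
  then show False
    using in_span_rest_lifted_zero[OF B b kvs.span_zero, of 1] by simp
qed

section \<open>Elementary changes of a standard basis\<close>

text \<open>
  The status \<open>True\<close> means inessential and \<open>False\<close> means essential. Making it a parameter lets one
  argument serve both for the greatest and for the smallest number of essential elements.
\<close>
definition has_status ::
    "bool \<Rightarrow> ('n::finite, 'k::field) mpol list \<Rightarrow> ('n, 'k) mpol \<Rightarrow> bool" where
  "has_status s bs f \<longleftrightarrow>
     f \<in> set bs \<and> (f \<in> saturation (ideal_gen (set bs - {f})) \<longleftrightarrow> s)"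

text \<open>
  The equivalence holds for each multiplier \<open>g\<close> separately, so the same power of the irrelevant
  ideal witnesses both sides.
\<close>
lemma saturation_affine:
  fixes f :: "('n::finite, 'k::field) mpol"
  assumes x: "x \<in> ideal_gen Y" and c: "c \<noteq> 0"
  shows "kscale c f + x \<in> saturation (ideal_gen Y) \<longleftrightarrow> f \<in> saturation (ideal_gen Y)"
proof -
  have "(kscale c f + x) * g \<in> ideal_gen Y \<longleftrightarrow> f * g \<in> ideal_gen Y" for g
  proof -
    have eq: "(kscale c f + x) * g = kscale c (f * g) + g * x"
      by (simp only: kscale_def distrib_right mult.assoc mult.commute[of x g])
    have gx: "g * x \<in> ideal_gen Y"
      using x by (rule ideal.span_scale)
    have "kscale c (f * g) \<in> ideal_gen Y \<longleftrightarrow> f * g \<in> ideal_gen Y"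
    proof
      assume "kscale c (f * g) \<in> ideal_gen Y"
      then have "kscale (1 / c) (kscale c (f * g)) \<in> ideal_gen Y"
        by (rule kscale_in_ideal)
      then show "f * g \<in> ideal_gen Y"
        using c by simp
    qed (rule kscale_in_ideal)
    then show ?thesis
      using gx by (simp add: eq ideal.span_add_eq2)
  qed
  then show ?thesis
    unfolding saturation_def by simp
qed

lemma standard_basis_nonzero:
  fixes I :: "('n::finite, 'k::field) mpol set"
  assumes B: "standard_basis I B" and b: "b \<in> set B"
  shows "b \<noteq> 0"
proof -
  obtain d where "b \<in> forms d"
    using standard_basisD(1)[OF B] b by blast
  then show ?thesis
    using standard_basis_not_generated_below[OF B b] ideal.span_zero by metis
qed

text \<open>
  Replacing \<open>b\<close> by \<open>f\<close> leaves the ideal of the other elements as it is, and modulo that ideal \<open>f\<close>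
  is a nonzero multiple of \<open>b\<close>; hence the status is inherited.
\<close>
lemma replace_one:
  fixes I :: "('n::finite, 'k::field) mpol set"
  assumes B: "standard_basis I B" and b: "b \<in> set B" "b \<in> forms d" and f: "f \<in> forms d"
    and eq: "f = kscale c b + j" and c: "c \<noteq> 0" and j: "j \<in> ideal_gen (set B - {b})"
  obtains B' where "standard_basis I B'" "f \<in> set B'" "has_status s B' f \<longleftrightarrow> has_status s B b"
proof -
  define g where "g = id(b := f)"
  have img: "g ` set B = insert f (set B - {b})"
    using b(1) by (auto simp: g_def)
  have deg: "g x \<in> forms e" if "x \<in> set B" "x \<in> forms e" for x e
    using form_degree_unique[OF b(2), of e] standard_basis_nonzero[OF B b(1)] that f
    by (auto simp: g_def)
  have jI: "j \<in> I"
    using j ideal.span_mono[of "set B - {b}" "set B"] standard_basisD(2)[OF B] by blast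
  have bI: "b \<in> I"
    using b(1) standard_basisD(2)[OF B] ideal.span_base by blast
  have gen: "ideal_gen (g ` set B) = I"
  proof (rule antisym)
    have "j \<in> ideal_gen (set B)" "b \<in> ideal_gen (set B)"
      using jI bI standard_basisD(2)[OF B] by simp_all
    then have "f \<in> ideal_gen (set B)"
      unfolding eq by (intro ideal.span_add kscale_in_ideal)
    then have "g ` set B \<subseteq> ideal_gen (set B)"
      using ideal.span_superset[of "set B"] img by auto
    then show "ideal_gen (g ` set B) \<subseteq> I"
      using ideal.span_minimal[OF _ ideal.subspace_span] standard_basisD(2)[OF B] by blast
    have "f \<in> ideal_gen (g ` set B)"
      unfolding img by (simp add: ideal.span_base)
    moreover have "j \<in> ideal_gen (g ` set B)"
      using j ideal.span_mono[of "set B - {b}" "g ` set B"] img by blast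
    ultimately have "kscale (1 / c) (f - j) \<in> ideal_gen (g ` set B)"
      by (intro kscale_in_ideal ideal.span_diff)
    moreover have "kscale (1 / c) (f - j) = b"
      using c by (simp add: eq)
    ultimately have "b \<in> ideal_gen (g ` set B)"
      by simp
    then have "set B \<subseteq> ideal_gen (g ` set B)"
      using ideal.span_superset[of "g ` set B"] img by blast
    then show "I \<subseteq> ideal_gen (g ` set B)"
      using ideal.span_minimal[OF _ ideal.subspace_span] standard_basisD(2)[OF B] by blast
  qed
  note map = standard_basis_map[OF B deg gen]
  have "f \<notin> set B - {b}"
  proof
    assume f': "f \<in> set B - {b}"
    then have "g f = g b"
      by (simp add: g_def)
    then show False
      using inj_onD[OF map(2)] f' b(1) by blast
  qed
  then have rest: "set (map g B) - {f} = set B - {b}"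
    using img by simp
  have "has_status s (map g B) f \<longleftrightarrow> has_status s B b"
    unfolding has_status_def rest using saturation_affine[OF j c, of b] img b(1) by (simp add: eq)
  then show ?thesis
    using that map(1) img by simp
qed

text \<open>
  The unipotent change of generators that keeps \<open>f\<close> and corrects every other generator by a
  multiple of \<open>f\<close>.
\<close>
definition shear :: "'r::comm_ring_1 \<Rightarrow> ('r \<Rightarrow> 'r) \<Rightarrow> 'r \<Rightarrow> 'r" where
  "shear f h b = (if b = f then f else b - h b * f)"

lemma ideal_gen_shear:
  assumes f: "f \<in> Y"
  shows "ideal_gen (shear f h ` Y) = ideal_gen Y"
proof (rule antisym; rule ideal.span_minimal[OF _ ideal.subspace_span]; rule subsetI)
  fix x
  assume "x \<in> shear f h ` Y"
  then obtain b where b: "b \<in> Y" "x = shear f h b"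
    by blast
  have "b - h b * f \<in> ideal_gen Y"
    using b(1) f by (intro ideal.span_diff ideal.span_scale ideal.span_base)
  then show "x \<in> ideal_gen Y"
    using b f by (simp add: shear_def ideal.span_base)
next
  fix b
  assume b: "b \<in> Y"
  have *: "f \<in> ideal_gen (shear f h ` Y)"
    using f by (intro ideal.span_base) (force simp: shear_def)
  show "b \<in> ideal_gen (shear f h ` Y)"
  proof (cases "b = f")
    case False
    have "shear f h b + h b * f \<in> ideal_gen (shear f h ` Y)"
      by (rule ideal.span_add[OF ideal.span_base[OF imageI[OF b]] ideal.span_scale[OF *]])
    then show ?thesis
      using False by (simp add: shear_def)
  qed (use * in simp)
qed

text \<open>
  Which representations modulo \<open>f\<close> are chosen does not matter: any forms \<open>Z\<close> inside the ideal \<open>J\<close>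
  generated by \<open>B - {f}\<close> that generate \<open>I\<close> together with \<open>f\<close> already generate \<open>J\<close>. A form
  \<open>x\<close> of \<open>J\<close> is \<open>q f + j\<close> with \<open>j\<close> in the ideal of \<open>Z\<close>, so \<open>q f\<close> lies in \<open>J\<close>, and one shows by
  induction on the degree that \<open>q f\<close> is in the ideal of \<open>Z\<close>. If \<open>q\<close> is a scalar, it is \<open>0\<close> because
  \<open>f\<close> is a minimal generator. If \<open>q\<close> has positive degree, then \<open>q f\<close> is in \<open>I\<^bsub>e-1\<^esub>S\<^sub>1\<close>, so the
  independence of the elements of \<open>B\<close> of degree \<open>e\<close> puts it into \<open>J\<^bsub>e-1\<^esub>S\<^sub>1\<close>, where the induction
  hypothesis applies.
\<close>
lemma ideal_gen_rest_eq:
  fixes I :: "('n::finite, 'k::field) mpol set"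
  assumes B: "standard_basis I B" and f: "f \<in> set B" "f \<in> forms d"
    and Z: "Z \<subseteq> (\<Union>d. forms d)" "Z \<subseteq> ideal_gen (set B - {f})"
    and gen: "ideal_gen (insert f Z) = I"
  shows "ideal_gen Z = ideal_gen (set B - {f})"
proof (rule antisym)
  let ?J = "ideal_gen (set B - {f})"
  show ZJ: "ideal_gen Z \<subseteq> ?J"
    using Z(2) by (rule ideal.span_minimal[OF _ ideal.subspace_span])
  have JI: "?J \<subseteq> I"
    using ideal.span_mono[of "set B - {f}" "set B"] standard_basisD(2)[OF B] by blast
  have forms: "set B - {f} \<subseteq> (\<Union>d. forms d)"
    using standard_basisD(1)[OF B] by blast
  have main: "x \<in> ideal_gen Z" if "x \<in> ?J" "x \<in> forms e" for x e
    using that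
  proof (induction e arbitrary: x rule: less_induct)
    case (less e)
    have "x \<in> ideal_gen (insert f Z)"
      using less.prems JI gen by blast
    then obtain q j where qj: "x = q * f + j" "j \<in> ideal_gen Z" "j \<in> forms e"
      "if d \<le> e then q \<in> forms (e - d) else q = 0"
      using ideal_gen_insert_split[OF f(2) Z(1) _ less.prems(2)] by blast
    have "q * f \<in> ideal_gen Z"
    proof (cases "d \<le> e")
      case True
      have qf: "q * f = x - j"
        using qj(1) by simp
      have "q * f \<in> ?J"
        unfolding qf using less.prems(1) qj(2) ZJ by (blast intro: ideal.span_diff)
      moreover have "q * f \<in> forms e"
        unfolding qf using less.prems(2) qj(3) by (rule forms_diff)
      ultimately obtain u where u: "u \<in> kspan ((set B - {f}) \<inter> forms e)"
          "q * f - u \<in> lifted_part ?J e"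
        using ideal_gen_graded_decomposition[OF forms] by blast
      have uI: "q * f - u \<in> lifted_part I e"
        using u(2) lifted_part_mono[OF JI] by blast
      show ?thesis
      proof (cases "e = d")
        case True
        define k where "k = Poly_Mapping.lookup q 0"
        have k: "q * f = kscale k f"
          unfolding k_def using qj(4) True by (intro form_0_scalar) simp
        then have "k = 0"
          using in_span_rest_lifted_zero[OF B f] u(1) uI True by simp
        then show ?thesis
          using k ideal.span_zero by simp
      next
        case False
        have "f \<in> ideal_gen (set B)"
          using f(1) by (rule ideal.span_base)
        moreover have "q \<in> forms (e - d)" "0 < e - d"
          using qj(4) True False by auto
        ultimately have "q * f \<in> lifted_part I (d + (e - d))"
          using mult_form_in_lifted_part[OF _ f(2)] standard_basisD(2)[OF B] by blast
        then have "q * f \<in> lifted_part I e"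
          using True by simp
        then have "q * f - (q * f - u) \<in> lifted_part I e"
          using kvs.subspace_diff[OF subspace_lifted_part _ uI] by blast
        then have uL: "u \<in> lifted_part I e"
          by simp
        have "u \<in> kspan (set B \<inter> forms e)"
          using u(1) kvs.span_mono[of "(set B - {f}) \<inter> forms e" "set B \<inter> forms e"] by blast
        then have "u = 0"
          using kvs.independent_mod_span_zero[OF _ standard_basisD(3)[OF B] _ uL] by blast
        then have "q * f \<in> lifted_part ?J e"
          using u(2) by simp
        moreover have "lifted_part ?J e \<subseteq> ideal_gen Z"
          unfolding lifted_part_def
        proof (rule kspan_subset_ideal_gen, safe)
          fix g l :: "('n, 'k) mpol"
          assume g: "g \<in> pred_part ?J e"
          have "g \<in> ideal_gen Z"
          proof (cases e)
            case (Suc e')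
            then show ?thesis
              using g less.IH[of e' g] by (simp add: pred_part_def graded_part_def)
          qed (use g in \<open>simp add: pred_part_def ideal.span_zero\<close>)
          then show "g * l \<in> ideal_gen Z"
            using ideal.span_scale[of g Z l] by (simp add: mult.commute)
        qed
        ultimately show ?thesis
          by blast
      qed
    qed (use qj(4) in \<open>simp add: ideal.span_zero\<close>)
    then show ?case
      unfolding qj(1) using qj(2) by (rule ideal.span_add)
  qed
  have "set B - {f} \<subseteq> ideal_gen Z"
  proof
    fix y
    assume y: "y \<in> set B - {f}"
    then obtain e where "y \<in> forms e"
      using forms by blast
    then show "y \<in> ideal_gen Z"
      by (rule main[OF ideal.span_base[OF y]])
  qed
  then show "?J \<subseteq> ideal_gen Z"
    by (rule ideal.span_minimal[OF _ ideal.subspace_span])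
qed

text \<open>
  The status that \<open>f\<close> has in \<open>C\<close> can be imposed on it in \<open>B\<close>. Shearing \<open>B\<close> along \<open>f\<close> so that its
  other elements fall into the ideal generated by \<open>C - {f}\<close> makes the two ideals that decide the
  status of \<open>f\<close> equal. A shear does not touch the ideal that decides the status of any other
  element, since that ideal contains \<open>f\<close>.
\<close>
lemma transplant_status:
  fixes I :: "('n::finite, 'k::field) mpol set"
  assumes B: "standard_basis I B" "f \<in> set B" and C: "standard_basis I C" "f \<in> set C"
  obtains g where "standard_basis I (map g B)" "inj_on g (set B)" "g f = f"
    "\<And>x e. x \<in> set B \<Longrightarrow> x \<in> forms e \<Longrightarrow> g x \<in> forms e"
    "\<And>s. has_status s (map g B) f \<longleftrightarrow> has_status s C f"
    "\<And>s x. x \<in> set B - {f} \<Longrightarrow> has_status s (map g B) (g x) \<longleftrightarrow> has_status s B x"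
proof -
  let ?J = "ideal_gen (set C - {f})"
  obtain d where d: "f \<in> forms d"
    using standard_basisD(1)[OF B(1)] B(2) by blast
  \<comment> \<open>One \<open>q\<close> serves every degree \<open>e\<close> of \<open>x\<close>, since \<open>x \<noteq> 0\<close> has only one.\<close>
  have "\<exists>q. (x - q * f \<in> ?J) \<and> (\<forall>e. x \<in> forms e \<longrightarrow> x - q * f \<in> forms e)" if x: "x \<in> set B" for x
  proof -
    obtain e where e: "x \<in> forms e"
      using standard_basisD(1)[OF B(1)] x by blast
    have "x \<in> ideal_gen (insert f (set C - {f}))"
      using x C(2) standard_basisD(2)[OF B(1)] standard_basisD(2)[OF C(1)] ideal.span_base
      by (metis insert_Diff)
    then obtain q j where q: "x = q * f + j" "j \<in> ?J" "j \<in> forms e"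
      using ideal_gen_insert_split[OF d _ _ e, of "set C - {f}"] standard_basisD(1)[OF C(1)] by blast
    have "e' = e" if "x \<in> forms e'" for e'
      using form_degree_unique[OF that e] standard_basis_nonzero[OF B(1) x] by blast
    then show ?thesis
      using q by (intro exI[of _ q]) auto
  qed
  then obtain h where h: "\<And>x. x \<in> set B \<Longrightarrow> x - h x * f \<in> ?J"
      "\<And>x e. x \<in> set B \<Longrightarrow> x \<in> forms e \<Longrightarrow> x - h x * f \<in> forms e"
    by metis
  define g where "g = shear f h"
  have gf: "g f = f" and gx: "x \<noteq> f \<Longrightarrow> g x = x - h x * f" for x
    by (simp_all add: g_def shear_def)
  have deg: "g x \<in> forms e" if "x \<in> set B" "x \<in> forms e" for x e
    using that h(2) gf gx by metis
  have gen: "ideal_gen (g ` set B) = I"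
    using ideal_gen_shear[OF B(2)] standard_basisD(2)[OF B(1)] by (simp add: g_def)
  note map = standard_basis_map[OF B(1) deg gen]
  have rest: "set (map g B) - {g x} = g ` (set B - {x})" if "x \<in> set B" for x
    using inj_on_image_set_diff[OF map(2), of "set B" "{x}"] that by simp
  have "ideal_gen (g ` (set B - {f})) = ?J"
  proof (rule ideal_gen_rest_eq[OF C d])
    show "g ` (set B - {f}) \<subseteq> (\<Union>d. forms d)"
      using standard_basisD(1)[OF map(1)] by auto
    show "g ` (set B - {f}) \<subseteq> ?J"
      using h(1) gx by auto
    have "insert f (g ` (set B - {f})) = g ` set B"
      using gf B(2) by force
    then show "ideal_gen (insert f (g ` (set B - {f}))) = I"
      using gen by simp
  qed
  then have 1: "has_status s (map g B) f \<longleftrightarrow> has_status s C f" for s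
    using rest[OF B(2)] gf B(2) C(2) unfolding has_status_def by force
  have 2: "has_status s (map g B) (g x) \<longleftrightarrow> has_status s B x" if x: "x \<in> set B - {f}" for s x
  proof -
    have f: "f \<in> set B - {x}"
      using x B(2) by blast
    have "ideal_gen (set (map g B) - {g x}) = ideal_gen (set B - {x})"
      using rest[of x] x ideal_gen_shear[OF f] by (simp add: g_def)
    moreover have "g x = kscale 1 x + (- h x) * f"
      using x gx by simp
    moreover have "(- h x) * f \<in> ideal_gen (set B - {x})"
      using f by (intro ideal.span_scale ideal.span_base)
    ultimately have "g x \<in> saturation (ideal_gen (set (map g B) - {g x})) \<longleftrightarrow>
        x \<in> saturation (ideal_gen (set B - {x}))"
      using saturation_affine[of "(- h x) * f" "set B - {x}" 1 x] by simp
    then show ?thesis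
      unfolding has_status_def using x by auto
  qed
  show ?thesis
    using that[OF map(1,2) gf deg 1 2] .
qed

section \<open>Maximal numbers of elements of one status\<close>

definition num_status ::
    "bool \<Rightarrow> ('n::finite, 'k::field) mpol list \<Rightarrow> nat \<Rightarrow> nat" where
  "num_status s bs d = card {f \<in> set bs. f \<in> forms d \<and> has_status s bs f}"

lemma num_status_add:
  "num_status s bs d + num_status (\<not> s) bs d = card (set bs \<inter> forms d)"
proof -
  have "set bs \<inter> forms d = {f \<in> set bs. f \<in> forms d \<and> has_status s bs f} \<union>
      {f \<in> set bs. f \<in> forms d \<and> has_status (\<not> s) bs f}"
    by (auto simp: has_status_def)
  moreover have "{f \<in> set bs. f \<in> forms d \<and> has_status s bs f} \<inter>
      {f \<in> set bs. f \<in> forms d \<and> has_status (\<not> s) bs f} = {}"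
    by (auto simp: has_status_def)
  ultimately show ?thesis
    unfolding num_status_def by (simp add: card_Un_disjoint)
qed

lemma num_status_increase:
  fixes I :: "('n::finite, 'k::field) mpol set"
  assumes B: "standard_basis I B" "has_status (\<not> s) B f" and f: "f \<in> forms d"
    and C: "standard_basis I C" "has_status s C f"
  shows "\<exists>B'. standard_basis I B' \<and> num_status s B d < num_status s B' d"
proof -
  have fB: "f \<in> set B" "f \<in> set C"
    using B(2) C(2) by (auto simp: has_status_def)
  obtain g where g: "standard_basis I (map g B)" "inj_on g (set B)" "g f = f"
    "\<And>x e. x \<in> set B \<Longrightarrow> x \<in> forms e \<Longrightarrow> g x \<in> forms e"
    "\<And>s. has_status s (map g B) f \<longleftrightarrow> has_status s C f"
    "\<And>s x. x \<in> set B - {f} \<Longrightarrow> has_status s (map g B) (g x) \<longleftrightarrow> has_status s B x"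
    using transplant_status[OF B(1) fB(1) C(1) fB(2)] by metis
  let ?A = "{x \<in> set B. x \<in> forms d \<and> has_status s B x}"
  have fA: "f \<notin> ?A"
    using B(2) by (auto simp: has_status_def)
  have "g ` insert f ?A \<subseteq> {x \<in> set (map g B). x \<in> forms d \<and> has_status s (map g B) x}"
  proof
    fix y
    assume "y \<in> g ` insert f ?A"
    then obtain x where x: "y = g x" "x = f \<or> x \<in> ?A"
      by blast
    have "x \<in> set B" "x \<in> forms d"
      using x(2) fB(1) f by auto
    moreover have "has_status s (map g B) (g x)"
    proof (cases "x = f")
      case True
      then show ?thesis
        using g(3,5) C(2) by simp
    next
      case False
      then show ?thesis
        using g(6)[of x s] x(2) by auto
    qed
    ultimately show "y \<in> {x \<in> set (map g B). x \<in> forms d \<and> has_status s (map g B) x}"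
      using g(4) x(1) by auto
  qed
  then have "card (g ` insert f ?A) \<le> num_status s (map g B) d"
    unfolding num_status_def by (intro card_mono) auto
  moreover have "card (g ` insert f ?A) = card (insert f ?A)"
    using fB(1) by (intro card_image inj_on_subset[OF g(2)]) auto
  moreover have "card (insert f ?A) = Suc (num_status s B d)"
    unfolding num_status_def using fA by (intro card_insert_disjoint) auto
  ultimately show ?thesis
    using g(1) by auto
qed

text \<open>
  The independent classes of the elements of \<open>B\<close> of status \<open>\<not> s\<close> lie in the span of the classes
  of the elements of \<open>C\<close> of that status, because a nonzero coefficient at an element of status \<open>s\<close>
  would allow an exchange that contradicts \<open>strong\<close>. Since both bases have the same number of
  elements of degree \<open>d\<close>, the comparison for \<open>\<not> s\<close> gives the reverse one for \<open>s\<close>.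
\<close>
lemma num_status_maximal:
  fixes I :: "('n::finite, 'k::field) mpol set"
  assumes B: "standard_basis I B" and C: "standard_basis I C"
    and strong: "\<And>f D. has_status (\<not> s) B f \<Longrightarrow> standard_basis I D \<Longrightarrow> f \<in> set D \<Longrightarrow>
      has_status (\<not> s) D f"
  shows "num_status s C d \<le> num_status s B d"
proof -
  let ?E = "{f \<in> set B. f \<in> forms d \<and> has_status (\<not> s) B f}"
  let ?T = "{f \<in> set C. f \<in> forms d \<and> has_status (\<not> s) C f}"
  have "card ?E \<le> card ?T"
  proof (rule kvs.card_le_if_independent_mod[OF _ _ subspace_lifted_part])
    show "kvs.independent_mod (lifted_part I d) ?E"
      by (rule kvs.independent_mod_mono[OF _ standard_basisD(3)[OF B, of d]]) auto
  next
    fix f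
    assume fE: "f \<in> ?E"
    then have fI: "f \<in> I"
      using standard_basisD(2)[OF B] ideal.span_base by blast
    then obtain u where u: "u \<in> kspan (set C \<inter> forms d)" "f - u \<in> lifted_part I d"
      using fE standard_basisD(4)[OF C] by blast
    obtain r where r: "u = (\<Sum>b\<in>set C \<inter> forms d. kscale (r b) b)"
      using u(1) kvs.span_finite[of "set C \<inter> forms d"] by auto
    have r0: "r b = 0" if b: "b \<in> set C" "b \<in> forms d" "has_status s C b" for b
    proof (rule ccontr)
      assume rb: "r b \<noteq> 0"
      let ?v = "\<Sum>x\<in>set C \<inter> forms d - {b}. kscale (r x) x"
      have "u = kscale (r b) b + ?v"
        unfolding r using b by (intro sum.remove) auto
      then have eq: "f = kscale (r b) b + (?v + (f - u))"
        by simp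
      have "?v \<in> ideal_gen (set C - {b})"
        by (intro ideal.span_sum kscale_in_ideal ideal.span_base) auto
      moreover have "f - u \<in> ideal_gen (set C - {b})"
        using lifted_part_subset_rest[OF C b(1,2)] u(2) by blast
      ultimately have j: "?v + (f - u) \<in> ideal_gen (set C - {b})"
        by (rule ideal.span_add)
      have "f \<in> forms d"
        using fE by blast
      then obtain D where D: "standard_basis I D" "f \<in> set D" "has_status s D f"
        using replace_one[OF C b(1,2) _ eq rb j, of s] b(3) by blast
      then have "has_status (\<not> s) D f"
        using strong fE by blast
      then show False
        using D(3) by (auto simp: has_status_def)
    qed
    have "kscale (r b) b \<in> kspan ?T" if b: "b \<in> set C \<inter> forms d" for b
    proof (cases "has_status s C b")
      case True
      then have "r b = 0"
        using r0 b by blast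
      then show ?thesis
        by (simp add: kvs.span_zero)
    next
      case False
      then have "b \<in> ?T"
        using b by (auto simp: has_status_def)
      then show ?thesis
        by (intro kvs.span_scale kvs.span_base)
    qed
    then have "u \<in> kspan ?T"
      unfolding r by (rule kvs.span_sum)
    then show "\<exists>u\<in>kspan ?T. f - u \<in> lifted_part I d"
      using u(2) by blast
  qed auto
  then show ?thesis
    using num_status_add[of s B d] num_status_add[of s C d] standard_basis_card_unique[OF B C, of d]
    by (simp add: num_status_def)
qed

lemma num_status_maximal_iff:
  fixes I :: "('n::finite, 'k::field) mpol set"
  assumes B: "standard_basis I B"
  shows "(\<forall>d C. standard_basis I C \<longrightarrow> num_status s C d \<le> num_status s B d) \<longleftrightarrow>
    (\<forall>f\<in>set B. has_status (\<not> s) B f \<longrightarrow>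
      (\<forall>D. standard_basis I D \<and> f \<in> set D \<longrightarrow> has_status (\<not> s) D f))"
    (is "?max \<longleftrightarrow> ?strong")
proof
  assume max: ?max
  show ?strong
  proof (intro ballI impI allI, rule ccontr)
    fix f D
    assume f: "f \<in> set B" "has_status (\<not> s) B f"
      and D: "standard_basis I D \<and> f \<in> set D" "\<not> has_status (\<not> s) D f"
    obtain d where d: "f \<in> forms d"
      using standard_basisD(1)[OF B] f(1) by blast
    have "has_status s D f"
      using D by (auto simp: has_status_def)
    then obtain B' where "standard_basis I B'" "num_status s B d < num_status s B' d"
      using num_status_increase[OF B f(2) d] D(1) by blast
    then show False
      using max by (meson not_le)
  qed
next
  assume strong: ?strong
  show ?max
  proof (intro allI impI num_status_maximal[OF B])
    fix f D
    assume "has_status (\<not> s) B f" "standard_basis I D" "f \<in> set D"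
    then show "has_status (\<not> s) D f"
      using strong unfolding has_status_def[of "\<not> s" B] by blast
  qed
qed

lemma standard_basis_element_new:
  fixes I :: "('n::finite, 'k::field) mpol set"
  assumes B: "standard_basis I B" and f: "f \<in> set B"
  shows "\<exists>d. f \<in> graded_part I d \<and> f \<notin> ideal_gen (pred_part I d)"
proof -
  obtain d where d: "f \<in> forms d"
    using standard_basisD(1)[OF B] f by blast
  moreover have "f \<in> I"
    using f standard_basisD(2)[OF B] ideal.span_base by blast
  ultimately show ?thesis
    using standard_basis_not_generated_below[OF B f d] by (auto simp: graded_part_def)
qed

text \<open>
  \<open>GREATEST\<close> is meaningful here because the number of essential elements of degree \<open>d\<close> is bounded by
  the number of all basis elements of degree \<open>d\<close>, which is common to all standard bases.
\<close>
lemma e_maximal_iff: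
  fixes I :: "('n::finite, 'k::field) mpol set"
  assumes B: "standard_basis I B"
  shows "e_maximal I B \<longleftrightarrow>
    (\<forall>d C. standard_basis I C \<longrightarrow> num_essential C d \<le> num_essential B d)"
proof -
  have bound: "num_essential C d \<le> card (set B \<inter> forms d)" if "standard_basis I C" for C d
  proof -
    have "num_essential C d \<le> card (set C \<inter> forms d)"
      unfolding num_essential_def by (rule card_mono) auto
    then show ?thesis
      using standard_basis_card_unique[OF B that] by simp
  qed
  show ?thesis
  proof
    assume max: "e_maximal I B"
    show "\<forall>d C. standard_basis I C \<longrightarrow> num_essential C d \<le> num_essential B d"
    proof (intro allI impI)
      fix d C
      assume C: "standard_basis I C"
      have "num_essential C d \<le> nu_e I d"
        unfolding nu_e_def
        by (rule Greatest_le_nat[where b = "card (set B \<inter> forms d)"]) (use C bound in auto)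
      then show "num_essential C d \<le> num_essential B d"
        using max by (simp add: e_maximal_def)
    qed
  next
    assume "\<forall>d C. standard_basis I C \<longrightarrow> num_essential C d \<le> num_essential B d"
    then have "nu_e I d = num_essential B d" for d
      unfolding nu_e_def using B by (intro Greatest_equality) auto
    then show "e_maximal I B"
      using B by (simp add: e_maximal_def)
  qed
qed

lemma e_minimal_iff:
  fixes I :: "('n::finite, 'k::field) mpol set"
  assumes B: "standard_basis I B"
  shows "e_minimal I B \<longleftrightarrow>
    (\<forall>d C. standard_basis I C \<longrightarrow> num_essential B d \<le> num_essential C d)"
proof
  assume min: "e_minimal I B"
  show "\<forall>d C. standard_basis I C \<longrightarrow> num_essential B d \<le> num_essential C d"
  proof (intro allI impI)
    fix d C
    assume C: "standard_basis I C"
    have "mu_e I d \<le> num_essential C d"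
      unfolding mu_e_def by (rule Least_le) (use C in auto)
    then show "num_essential B d \<le> num_essential C d"
      using min by (simp add: e_minimal_def)
  qed
next
  assume "\<forall>d C. standard_basis I C \<longrightarrow> num_essential B d \<le> num_essential C d"
  then have "mu_e I d = num_essential B d" for d
    unfolding mu_e_def using B by (intro Least_equality) auto
  then show "e_minimal I B"
    using B by (simp add: e_minimal_def)
qed

theorem theorem5p1:
  fixes I :: "('n::finite, 'k::alg_closed_field) mpol set"
    and B :: "('n, 'k) mpol list"
  assumes "homogeneous_ideal I"
    and "saturation I \<subset> irrelevant"
    and "standard_basis I B"
  shows "(e_maximal I B \<longleftrightarrow> (\<forall>f\<in>set B. inessential B f \<longrightarrow> strongly_inessential I f)) \<and>
         (e_minimal I B \<longleftrightarrow> (\<forall>f\<in>set B. essential B f \<longrightarrow> strongly_essential I f))"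
proof
  note B = assms(3)
  have status: "inessential bs f \<longleftrightarrow> has_status True bs f" "essential bs f \<longleftrightarrow> has_status False bs f"
    for bs and f :: "('n, 'k) mpol"
    by (simp_all add: inessential_def essential_def has_status_def)
  have num: "num_essential bs d = num_status False bs d" for bs :: "('n, 'k) mpol list" and d
    by (simp add: num_essential_def num_status_def status)
  show "e_maximal I B \<longleftrightarrow> (\<forall>f\<in>set B. inessential B f \<longrightarrow> strongly_inessential I f)"
    unfolding e_maximal_iff[OF B] num num_status_maximal_iff[OF B] strongly_inessential_def status
    using standard_basis_element_new[OF B] by simp
  \<comment> \<open>The fewest essential elements means the most inessential ones, as the total is fixed.\<close>
  have "num_essential B d \<le> num_essential C d \<longleftrightarrow> num_status True C d \<le> num_status True B d"
    if "standard_basis I C" for C d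
    using num_status_add[of True B d] num_status_add[of True C d]
      standard_basis_card_unique[OF B that, of d] by (simp add: num) linarith
  then have "e_minimal I B \<longleftrightarrow>
      (\<forall>d C. standard_basis I C \<longrightarrow> num_status True C d \<le> num_status True B d)"
    unfolding e_minimal_iff[OF B] by blast
  then show "e_minimal I B \<longleftrightarrow> (\<forall>f\<in>set B. essential B f \<longrightarrow> strongly_essential I f)"
    unfolding num_status_maximal_iff[OF B] strongly_essential_def status
    using standard_basis_element_new[OF B] by simp
qed

end
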